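(* Let $N\geq 1$ be an integer, and let $\{p_\alpha : \alpha\in\mathcal{A}\}$ and $\{p'_\alpha : \alpha\in\mathcal{A}\}$ be two collections of distinct points in $\mathbb{R}^N_\infty$, indexed by the same set $\mathcal{A}$ (so $p_\alpha\neq p_\beta$ and $p'_\alpha\neq p'_\beta$ whenever $\alpha\neq\beta$). Then there is a Möbius transformation $f$ of $\mathbb{R}^N_\infty$ with $f(p_\alpha)=p'_\alpha$ for each $\alpha\in\mathcal{A}$ if and only if $$|p_\alpha,p_\beta,p_\gamma,p_\delta|=|p'_\alpha,p'_\beta,p'_\gamma,p'_\delta|$$ for all ordered $4$-tuples $(\alpha,\beta,\gamma,\delta)$ of distinct indices in $\mathcal{A}$.
   Context: $\mathbb{R}^N_\infty=\mathbb{R}^N\cup\{\infty\}$ is the one-point extension (compactification) of $\mathbb{R}^N$. A sphere in $\mathbb{R}^N_\infty$ is either an $(N-1)$-dimensional Euclidean sphere in $\mathbb{R}^N$, or an $(N-1)$-dimensional Euclidean (affine) plane in $\mathbb{R}^N$ with the point $\infty$ attached. An inversion in a sphere is the Euclidean inversion in it if it is a Euclidean sphere, and the Euclidean reflection in it (fixing $\infty$) if it is a Euclidean plane with $\infty$ attached. The group of Möbius transformations of $\mathbb{R}^N_\infty$ is the group generated by inversions in spheres (so it includes orientation-reversing maps). For four distinct points $a,b,c,d$ of $\mathbb{R}^N_\infty$, the absolute cross-ratio is $$|a,b,c,d|=\frac{|a-b|\,|c-d|}{|a-c|\,|b-d|},$$ where $|\cdot|$ on the right is the Euclidean norm, with the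 usual convention that if one of the points is $\infty$ then the two factors containing it (one in the numerator, one in the denominator) are deleted. *)

theory Defs
  imports "HOL-Analysis.Analysis" "HOL-Algebra.Bij" "HOL-Algebra.Generated_Groups"
begin

text \<open>
  The one-point extension of Euclidean space: \<open>Some x\<close> is the finite point \<open>x\<close>, and \<open>None\<close> is
  the point at infinity (the same encoding as in \<open>Alexandroff_compactification\<close>).
\<close>

type_synonym 'n ext_space = "(real^'n) option"

abbreviation infty :: "'n::finite ext_space" where
  "infty \<equiv> None"

fun sphere_inversion :: "real^'n \<Rightarrow> real \<Rightarrow> 'n::finite ext_space \<Rightarrow> 'n ext_space" where
  "sphere_inversion c r None = Some c"
| "sphere_inversion c r (Some x) =
     (if x = c then infty else Some (c + (r\<^sup>2 / (norm (x - c))\<^sup>2) *\<^sub>R (x - c)))"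

fun plane_reflection :: "real^'n \<Rightarrow> real \<Rightarrow> 'n::finite ext_space \<Rightarrow> 'n ext_space" where
  "plane_reflection a b None = infty"
| "plane_reflection a b (Some x) = Some (x - (2 * (a \<bullet> x - b) / (a \<bullet> a)) *\<^sub>R a)"

text \<open>
  \<open>inversion_in S f\<close>: the set \<open>S\<close> is a sphere of the extended space, and \<open>f\<close> is the inversion
  in it. The \<open>(N - 1)\<close>-dimensional affine planes are the sets \<open>{x. a \<bullet> x = b}\<close> with \<open>a \<noteq> 0\<close>, see
  \<open>hyperplane_iff_affine_aff_dim\<close> below.
\<close>

inductive inversion_in :: "'n::finite ext_space set \<Rightarrow> ('n ext_space \<Rightarrow> 'n ext_space) \<Rightarrow> bool" where
  sphere: "r > 0 \<Longrightarrow> inversion_in (Some ` sphere c r) (sphere_inversion c r)"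
| plane: "a \<noteq> 0 \<Longrightarrow> inversion_in (insert infty (Some ` {x. a \<bullet> x = b})) (plane_reflection a b)"

definition mobius_group :: "('n::finite ext_space \<Rightarrow> 'n ext_space) set" where
  "mobius_group = generate (BijGroup UNIV) {f. \<exists>S. inversion_in S f}"

text \<open>
  The value 1 when a point is infinite implements the convention that the factors of a
  cross-ratio which contain \<open>infty\<close> are deleted.
\<close>

fun cr_factor :: "'n::finite ext_space \<Rightarrow> 'n ext_space \<Rightarrow> real" where
  "cr_factor (Some x) (Some y) = norm (x - y)"
| "cr_factor _ _ = 1"

definition abs_cross_ratio ::
  "'n::finite ext_space \<Rightarrow> 'n ext_space \<Rightarrow> 'n ext_space \<Rightarrow> 'n ext_space \<Rightarrow> real" where
  "abs_cross_ratio a b c d =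
     (cr_factor a b * cr_factor c d) / (cr_factor a c * cr_factor b d)"

lemma hyperplane_iff_affine_aff_dim:
  fixes H :: "(real^'n) set"
  shows "affine H \<and> aff_dim H = int CARD('n) - 1 \<longleftrightarrow> (\<exists>a b. a \<noteq> 0 \<and> H = {x. a \<bullet> x = b})"
proof
  assume H: "affine H \<and> aff_dim H = int CARD('n) - 1"
  then have "affine hull H = H"
    by (simp add: affine_hull_eq)
  moreover have "\<exists>a b. a \<noteq> 0 \<and> affine hull H = {x. a \<bullet> x = b}"
    using H aff_dim_eq_hyperplane[of H] by simp
  ultimately show "\<exists>a b. a \<noteq> 0 \<and> H = {x. a \<bullet> x = b}"
    by metis
qed (auto simp: affine_hyperplane)

text \<open>
  The formula of \<open>plane_reflection\<close> is the Euclidean reflection: the midpoint of \<open>x\<close> and its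
  image is the orthogonal projection of \<open>x\<close> to the plane.
\<close>

lemma plane_reflection_closest_point:
  fixes a x :: "real^'n"
  assumes "a \<noteq> 0"
  shows "plane_reflection a b (Some x) = Some (2 *\<^sub>R closest_point {y. a \<bullet> y = b} x - x)"
proof -
  define p where "p = x - ((a \<bullet> x - b) / (a \<bullet> a)) *\<^sub>R a"
  have p: "a \<bullet> p = b"
    using assms by (simp add: p_def inner_diff_right)
  have "dist x p \<le> dist x y" if "a \<bullet> y = b" for y
  proof -
    have "(x - p) \<bullet> (p - y) = 0"
    proof -
      have "a \<bullet> (p - y) = 0"
        using p that by (simp add: inner_diff_right)
      moreover have "x - p = ((a \<bullet> x - b) / (a \<bullet> a)) *\<^sub>R a"
        by (simp add: p_def)
      ultimately show ?thesis
        by simp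
    qed
    then have "(norm (x - y))\<^sup>2 = (norm (x - p))\<^sup>2 + (norm (p - y))\<^sup>2"
      using norm_add_Pythagorean[of "x - p" "p - y"] by (simp add: orthogonal_def)
    then show ?thesis
      by (simp add: dist_norm power2_le_imp_le)
  qed
  then have "p = closest_point {y. a \<bullet> y = b} x"
    by (intro closest_point_unique) (auto simp: p convex_hyperplane closed_hyperplane)
  moreover have "plane_reflection a b (Some x) = Some (2 *\<^sub>R p - x)"
    by (simp add: p_def scaleR_diff_right scaleR_2 algebra_simps)
  ultimately show ?thesis
    by simp
qed

lemma sphere_inversion_involution:
  assumes "r > 0"
  shows "sphere_inversion c r (sphere_inversion c r p) = p"
  using assms by (cases p) (auto simp: power_divide power2_eq_square)

lemma plane_reflection_involution:
  assumes "a \<noteq> 0"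
  shows "plane_reflection a b (plane_reflection a b p) = p"
proof (cases p)
  case (Some x)
  define t where "t = 2 * (a \<bullet> x - b) / (a \<bullet> a)"
  have "2 * (a \<bullet> (x - t *\<^sub>R a) - b) / (a \<bullet> a) = - t"
    using assms by (simp add: t_def inner_diff_right field_simps)
  then show ?thesis
    using Some by (simp add: t_def)
qed simp

lemma inversion_in_involution:
  assumes "inversion_in S f"
  shows "f (f p) = p"
  using assms
  by cases (simp_all add: sphere_inversion_involution plane_reflection_involution)

lemma inversion_in_Bij:
  assumes "inversion_in S f"
  shows "f \<in> carrier (BijGroup UNIV)"
  using inversion_in_involution[OF assms]
  by (auto simp: BijGroup_def Bij_def extensional_def intro: bij_betwI[where g = f])

lemma subgroup_mobius_group: "subgroup mobius_group (BijGroup UNIV)"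
  unfolding mobius_group_def
  by (rule group.generate_is_subgroup[OF group_BijGroup]) (auto simp: inversion_in_Bij)

end

theory Submission
  imports Defs
begin

text \<open>
  An inversion multiplies the distance of two points \<open>a\<close>, \<open>b\<close> by a product \<open>w a * w b\<close>, and such
  weights cancel in a cross-ratio. Conversely, move one point of each family to infinity by
  inversions: the cross-ratios containing infinity then say that the remaining points are
  related by a similarity. After a scaling they are related by an isometry, which is realised by
  reflections in perpendicular bisectors. Such a reflection fixes the points that are already
  in place, and each of them increases the dimension of the affine span of these points, so
  finitely many suffice even for an infinite family.
\<close>

section \<open>Closure and induction for the group generated by inversions\<close>

lemma mobius_group_id: "id \<in> mobius_group"
  using subgroup.one_closed[OF subgroup_mobius_group]
  by (simp add: BijGroup_def id_def restrict_UNIV)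

lemma mobius_group_comp:
  assumes "f \<in> mobius_group" "g \<in> mobius_group"
  shows "f \<circ> g \<in> mobius_group"
proof -
  have "f \<in> Bij UNIV" "g \<in> Bij UNIV"
    using assms subgroup.subset[OF subgroup_mobius_group] by (auto simp: BijGroup_def)
  then show ?thesis
    using subgroup.m_closed[OF subgroup_mobius_group assms]
    by (simp add: BijGroup_def compose_def comp_def restrict_UNIV)
qed

lemma inversion_in_mobius_group: "inversion_in S f \<Longrightarrow> f \<in> mobius_group"
  unfolding mobius_group_def by (auto intro: generate.incl)

text \<open>\<open>generate\<close> adjoins inverses of generators only, and every inversion is its
  own inverse, so the inverse case falls under \<open>inversion\<close>.\<close>

lemma mobius_group_induct [consumes 1, case_names id inversion comp]:
  assumes "f \<in> mobius_group"
    and "P id"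
    and inversion: "\<And>S f. inversion_in S f \<Longrightarrow> P f"
    and comp: "\<And>f g. P f \<Longrightarrow> P g \<Longrightarrow> P (f \<circ> g)"
  shows "P f"
  using assms(1) unfolding mobius_group_def
proof (induction rule: generate.induct)
  case one
  then show ?case
    using \<open>P id\<close> by (simp add: BijGroup_def id_def restrict_UNIV)
next
  case (incl h)
  then show ?case
    using inversion by blast
next
  case (inv h)
  then obtain S where S: "inversion_in S h"
    by blast
  have carrier: "h \<in> carrier (BijGroup UNIV)"
    by (rule inversion_in_Bij[OF S])
  then have "h \<otimes>\<^bsub>BijGroup UNIV\<^esub> h = \<one>\<^bsub>BijGroup UNIV\<^esub>"
    by (simp add: BijGroup_def compose_def inversion_in_involution[OF S])
  then have "inv\<^bsub>BijGroup UNIV\<^esub> h = h"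
    using carrier group.inv_equality[OF group_BijGroup] by blast
  then show ?case
    using inversion[OF S] by simp
next
  case (eng g h)
  then have "g \<in> Bij UNIV" "h \<in> Bij UNIV"
    using subgroup.subset[OF subgroup_mobius_group]
    by (auto simp: BijGroup_def mobius_group_def)
  then have "g \<otimes>\<^bsub>BijGroup UNIV\<^esub> h = g \<circ> h"
    by (simp add: BijGroup_def compose_def comp_def restrict_UNIV)
  then show ?case
    using comp[OF eng.IH] by (simp only:)
qed

section \<open>Distortion of distances and invariance of the cross-ratio\<close>

text \<open>The law is stated off the diagonal because a finite \<open>a\<close> sent to
  \<open>infty\<close> has \<open>cr_factor (f a) (f a) = 1\<close> but
  \<open>cr_factor a a = 0\<close>. Injectivity keeps distinct points distinct, so that the laws of
  two maps can be chained.\<close>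

definition weighted_map :: "('n::finite ext_space \<Rightarrow> 'n ext_space) \<Rightarrow> bool" where
  "weighted_map f \<longleftrightarrow> inj f \<and> (\<exists>w. (\<forall>a. w a > 0) \<and>
     (\<forall>a b. a \<noteq> b \<longrightarrow> cr_factor (f a) (f b) = w a * w b * cr_factor a b))"

lemma weighted_map_comp:
  assumes "weighted_map f" "weighted_map g"
  shows "weighted_map (f \<circ> g)"
proof -
  obtain v where v: "\<And>a. v a > 0"
      "\<And>a b. a \<noteq> b \<Longrightarrow> cr_factor (f a) (f b) = v a * v b * cr_factor a b"
    using assms(1) unfolding weighted_map_def by blast
  obtain w where w: "\<And>a. w a > 0"
      "\<And>a b. a \<noteq> b \<Longrightarrow> cr_factor (g a) (g b) = w a * w b * cr_factor a b"
    using assms(2) unfolding weighted_map_def by blast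
  have inj: "inj f" "inj g"
    using assms by (auto simp: weighted_map_def)
  have "cr_factor ((f \<circ> g) a) ((f \<circ> g) b)
      = (v (g a) * w a) * (v (g b) * w b) * cr_factor a b" if "a \<noteq> b" for a b
    using that inj(2) by (simp add: v(2) w(2) inj_eq)
  then show ?thesis
    using inj v(1) w(1) unfolding weighted_map_def
    by (intro conjI inj_compose exI[of _ "\<lambda>a. v (g a) * w a"]) auto
qed

text \<open>The scaled vectors have norms \<open>\<bar>s\<bar> / norm u\<close> and
  \<open>\<bar>s\<bar> / norm v\<close> and enclose the same angle as \<open>u\<close> and
  \<open>v\<close>, so the two triangles with apex 0 are similar. The computation is the law of
  cosines.\<close>

lemma dist_inversion:
  fixes u v :: "'a::real_inner"
  assumes "u \<noteq> 0" "v \<noteq> 0"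
  shows "norm ((s / (norm u)\<^sup>2) *\<^sub>R u - (s / (norm v)\<^sup>2) *\<^sub>R v)
    = \<bar>s\<bar> * norm (u - v) / (norm u * norm v)"
proof (rule power2_eq_imp_eq)
  have "(norm ((s / (norm u)\<^sup>2) *\<^sub>R u - (s / (norm v)\<^sup>2) *\<^sub>R v))\<^sup>2
      = (s / (norm u)\<^sup>2)\<^sup>2 * (norm u)\<^sup>2 + (s / (norm v)\<^sup>2)\<^sup>2 * (norm v)\<^sup>2
        - 2 * (s / (norm u)\<^sup>2) * (s / (norm v)\<^sup>2) * (u \<bullet> v)"
    unfolding power2_norm_eq_inner
    by (simp add: inner_diff inner_commute power2_eq_square)
  also have "\<dots> = s\<^sup>2 * ((norm u)\<^sup>2 + (norm v)\<^sup>2 - 2 * (u \<bullet> v)) / ((norm u)\<^sup>2 * (norm v)\<^sup>2)"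
    using assms by (simp add: field_simps power2_eq_square)
  also have "(norm u)\<^sup>2 + (norm v)\<^sup>2 - 2 * (u \<bullet> v) = (norm (u - v))\<^sup>2"
    unfolding power2_norm_eq_inner by (simp add: inner_diff inner_commute)
  finally show "(norm ((s / (norm u)\<^sup>2) *\<^sub>R u - (s / (norm v)\<^sup>2) *\<^sub>R v))\<^sup>2
      = (\<bar>s\<bar> * norm (u - v) / (norm u * norm v))\<^sup>2"
    by (simp add: power_mult_distrib power_divide)
qed auto

text \<open>The offset \<open>b\<close> cancels in the difference. What remains is the linear
  reflection of \<open>x - y\<close>, which is orthogonal.\<close>

lemma norm_plane_reflection_diff:
  fixes a x y :: "real^'n"
  assumes "a \<noteq> 0"
  shows "norm ((x - (2 * (a \<bullet> x - b) / (a \<bullet> a)) *\<^sub>R a) - (y - (2 * (a \<bullet> y - b) / (a \<bullet> a)) *\<^sub>R a))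
    = norm (x - y)"
proof -
  define z where "z = x - y"
  define t where "t = 2 * (a \<bullet> z) / (a \<bullet> a)"
  have t: "t * (a \<bullet> a) = 2 * (a \<bullet> z)"
    using assms by (simp add: t_def)
  have "(x - (2 * (a \<bullet> x - b) / (a \<bullet> a)) *\<^sub>R a) - (y - (2 * (a \<bullet> y - b) / (a \<bullet> a)) *\<^sub>R a)
      = z - t *\<^sub>R a"
    by (simp add: z_def t_def algebra_simps diff_divide_distrib inner_diff_right)
  moreover have "(z - t *\<^sub>R a) \<bullet> (z - t *\<^sub>R a) = z \<bullet> z"
    using t by (simp add: inner_diff inner_commute algebra_simps)
  ultimately show ?thesis
    unfolding norm_eq_sqrt_inner z_def by presburger
qed

lemma weighted_map_sphere_inversion:
  fixes c :: "real^'n"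
  assumes "r > 0"
  shows "weighted_map (sphere_inversion c r)"
proof -
  \<comment> \<open>The generic weight comes from \<open>dist_inversion\<close> with
    \<open>s\<close> equal to the squared radius. The deleted factors dictate the other two: a
    finite \<open>x \<noteq> c\<close> paired with \<open>infty\<close> has images at distance
    \<open>r * r / norm (x - c)\<close>, and paired with \<open>c\<close> it has an image factor
    1.\<close>
  define w where "w p = (case p of None \<Rightarrow> r | Some x \<Rightarrow> if x = c then 1 / r else r / norm (x - c))"
    for p :: "'n ext_space"
  have pos: "w p > 0" for p
    using assms by (auto simp: w_def split: option.split)
  have far: "cr_factor (sphere_inversion c r (Some x)) (sphere_inversion c r None) = w (Some x) * w None"
    for x
    using assms by (simp add: w_def power2_eq_square)
  have near: "cr_factor (sphere_inversion c r (Some x)) (sphere_inversion c r (Some y))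
      = w (Some x) * w (Some y) * norm (x - y)" if "x \<noteq> y" for x y
    using assms that dist_inversion[of "x - c" "y - c" "r\<^sup>2"]
    by (auto simp: w_def power2_eq_square norm_minus_commute)
  have commute: "cr_factor p q = cr_factor q p" for p q :: "'n ext_space"
    by (cases p; cases q) (auto simp: norm_minus_commute)
  have "cr_factor (sphere_inversion c r p) (sphere_inversion c r q) = w p * w q * cr_factor p q"
    if "p \<noteq> q" for p q
    using that far near commute
    by (cases p; cases q) (auto simp del: sphere_inversion.simps simp: mult.commute)
  moreover have "inj (sphere_inversion c r)"
    by (rule inj_on_inverseI[where g = "sphere_inversion c r"]) (rule sphere_inversion_involution[OF assms])
  ultimately show ?thesis
    using pos unfolding weighted_map_def by blast
qed

lemma weighted_map_plane_reflection:
  fixes a :: "real^'n"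
  assumes "a \<noteq> 0"
  shows "weighted_map (plane_reflection a b)"
proof -
  have "cr_factor (plane_reflection a b p) (plane_reflection a b q) = 1 * 1 * cr_factor p q" for p q
    by (cases p; cases q) (simp_all only: plane_reflection.simps cr_factor.simps
      norm_plane_reflection_diff[OF assms] mult_1)
  moreover have "inj (plane_reflection a b)"
    by (rule inj_on_inverseI[where g = "plane_reflection a b"]) (rule plane_reflection_involution[OF assms])
  ultimately show ?thesis
    unfolding weighted_map_def by (intro conjI exI[of _ "\<lambda>_. 1"]) auto
qed

lemma weighted_map_mobius: "f \<in> mobius_group \<Longrightarrow> weighted_map f"
proof (induction rule: mobius_group_induct)
  case id
  show ?case
    unfolding weighted_map_def by (intro conjI exI[of _ "\<lambda>_. 1"]) auto
next
  case (inversion S f)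
  then show ?case
    by cases (simp_all add: weighted_map_sphere_inversion weighted_map_plane_reflection)
qed (rule weighted_map_comp)

lemma inj_mobius: "f \<in> mobius_group \<Longrightarrow> inj f"
  using weighted_map_mobius unfolding weighted_map_def by blast

lemma abs_cross_ratio_mobius:
  assumes "f \<in> mobius_group" "distinct [a, b, c, d]"
  shows "abs_cross_ratio (f a) (f b) (f c) (f d) = abs_cross_ratio a b c d"
proof -
  obtain w where w: "\<And>a. w a > 0"
      "\<And>a b. a \<noteq> b \<Longrightarrow> cr_factor (f a) (f b) = w a * w b * cr_factor a b"
    using weighted_map_mobius[OF assms(1)] unfolding weighted_map_def by blast
  \<comment> \<open>Each point occurs in exactly one factor of the numerator and one of the
    denominator, so both acquire the same product of weights.\<close>
  have "abs_cross_ratio (f a) (f b) (f c) (f d)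
      = ((w a * w b * w c * w d) * (cr_factor a b * cr_factor c d))
        / ((w a * w b * w c * w d) * (cr_factor a c * cr_factor b d))"
    using assms(2) by (simp add: abs_cross_ratio_def w(2) mult_ac)
  moreover have "w a * w b * w c * w d \<noteq> 0"
    using w(1)[of a] w(1)[of b] w(1)[of c] w(1)[of d] by simp
  ultimately show ?thesis
    by (simp add: abs_cross_ratio_def)
qed

section \<open>Normalising maps\<close>

text \<open>A finite point is the centre of a unit sphere, whose inversion sends it to
  \<open>infty\<close>. The involution clause lets \<open>g\<close> also undo the
  normalisation.\<close>

lemma mobius_to_infty:
  fixes q :: "'n::finite ext_space"
  obtains g where "g \<in> mobius_group" "g q = infty" "\<And>p. g (g p) = p"
proof (cases q)
  case None
  then show ?thesis
    using that[of id] mobius_group_id by simp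
next
  case (Some c)
  then show ?thesis
    using that[of "sphere_inversion c 1"] inversion_in_mobius_group[OF inversion_in.sphere[of 1 c]]
      sphere_inversion_involution[of 1 c]
    by simp
qed

text \<open>Inversions in two concentric spheres compose to a dilation by the squared quotient of
  the radii, here \<open>sqrt k\<close> and 1.\<close>

lemma mobius_scaling:
  assumes "k > 0"
  obtains g :: "'n::finite ext_space \<Rightarrow> 'n ext_space"
    where "g \<in> mobius_group" "g infty = infty" "\<And>x. g (Some x) = Some (k *\<^sub>R x)"
proof
  let ?g = "sphere_inversion (0::real^'n) (sqrt k) \<circ> sphere_inversion 0 1"
  show "?g \<in> mobius_group"
    using assms by (intro mobius_group_comp inversion_in_mobius_group[OF inversion_in.sphere]) auto
  show "?g infty = infty"
    by simp
  show "?g (Some x) = Some (k *\<^sub>R x)" for x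
    using assms by (cases "x = 0") (auto simp: power2_eq_square)
qed

section \<open>Extending isometries by reflections\<close>

text \<open>After squaring, the norm of \<open>z\<close> cancels and a linear equation is left. It
  presents the bisector by the parameters that \<open>plane_reflection\<close> takes.\<close>

lemma equidistant_iff_bisector:
  fixes x y z :: "'a::real_inner"
  shows "norm (z - x) = norm (z - y) \<longleftrightarrow> (x - y) \<bullet> z = ((norm x)\<^sup>2 - (norm y)\<^sup>2) / 2"
  unfolding norm_eq power2_norm_eq_inner
  by (auto simp: inner_diff inner_commute field_simps)

text \<open>
  Induction on the codimension of the affine span of the points already in place. A point that
  is not in place is not on the bisector of itself and its target, while these points are.
\<close>

lemma mobius_extends_isometry:
  fixes x y :: "'i \<Rightarrow> real^'n"
  assumes "\<And>a b. a \<in> B \<Longrightarrow> b \<in> B \<Longrightarrow> norm (x a - x b) = norm (y a - y b)"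
  shows "\<exists>f\<in>mobius_group. f infty = infty \<and> (\<forall>a\<in>B. f (Some (x a)) = Some (y a))"
  using assms
\<comment> \<open>The targets \<open>y\<close> stay fixed, while \<open>x\<close> is generalised:
  after a reflection its images form the new starting family.\<close>
proof (induction "nat (int CARD('n) - aff_dim (x ` {a\<in>B. x a = y a}))" arbitrary: x rule: less_induct)
  case less
  let ?F = "x ` {a\<in>B. x a = y a}"
  show ?case
  proof (cases "\<forall>a\<in>B. x a = y a")
    case True
    then show ?thesis
      using mobius_group_id by (intro bexI[of _ id]) auto
  next
    case False
    then obtain a where a: "a \<in> B" "x a \<noteq> y a"
      by blast
    define n where "n = x a - y a"
    define m where "m = ((norm (x a))\<^sup>2 - (norm (y a))\<^sup>2) / 2"
    define \<rho> where "\<rho> z = z - (2 * (n \<bullet> z - m) / (n \<bullet> n)) *\<^sub>R n" for z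
    have n: "n \<noteq> 0"
      using a by (simp add: n_def)
    have reflection: "plane_reflection n m (Some z) = Some (\<rho> z)" for z
      by (simp add: \<rho>_def)
    have H: "norm (z - x a) = norm (z - y a) \<longleftrightarrow> n \<bullet> z = m" for z
      unfolding n_def m_def by (rule equidistant_iff_bisector)
    \<comment> \<open>A point with \<open>x b = y b\<close> is as far from \<open>x a\<close> as
      from \<open>y a\<close>, by the distance hypothesis for \<open>b\<close> and
      \<open>a\<close>.\<close>
    have F: "?F \<subseteq> {z. n \<bullet> z = m}"
    proof safe
      fix b assume "b \<in> B" "x b = y b"
      then show "n \<bullet> x b = m"
        using less.prems[OF \<open>b \<in> B\<close> a(1)] H[of "x b"] by simp
    qed
    have moved: "\<rho> (x a) = y a"
    proof -
      have "2 * (n \<bullet> x a - m) = n \<bullet> n"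
        unfolding n_def m_def power2_norm_eq_inner
        by (simp add: inner_diff inner_commute field_simps)
      then show ?thesis
        using n by (simp add: \<rho>_def n_def)
    qed
    have fixed: "\<rho> z = z" if "z \<in> ?F" for z
      using F that by (auto simp: \<rho>_def)
    have iso: "norm (\<rho> (x c) - \<rho> (x b)) = norm (y c - y b)" if "c \<in> B" "b \<in> B" for b c
      using norm_plane_reflection_diff[OF n] less.prems[OF that] by (simp add: \<rho>_def)
    let ?G = "(\<rho> \<circ> x) ` {b\<in>B. (\<rho> \<circ> x) b = y b}"
    have "insert (y a) ?F \<subseteq> ?G"
      using fixed moved a by (force simp: image_iff)
    then have "aff_dim (insert (y a) ?F) \<le> aff_dim ?G"
      by (rule aff_dim_subset)
    \<comment> \<open>The mirror is affine and so contains the hull of \<open>?F\<close>. If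
      \<open>y a\<close> were on it, its distance to \<open>x a\<close> would equal its distance 0
      to itself.\<close>
    moreover have "y a \<notin> affine hull ?F"
    proof
      assume "y a \<in> affine hull ?F"
      then have "n \<bullet> y a = m"
        using hull_minimal[OF F, of affine] affine_hyperplane by blast
      then show False
        using H[of "y a"] a by simp
    qed
    ultimately have "aff_dim ?F < aff_dim ?G"
      by (simp add: aff_dim_insert)
    \<comment> \<open>With this bound the old codimension is positive, so the strict decrease
      survives the truncation by \<open>nat\<close>.\<close>
    moreover have "aff_dim ?G \<le> int CARD('n)"
      using aff_dim_le_DIM[of ?G] by simp
    ultimately have "nat (int CARD('n) - aff_dim ?G) < nat (int CARD('n) - aff_dim ?F)"
      by linarith
    then obtain f where f: "f \<in> mobius_group" "f infty = infty"
        "\<forall>b\<in>B. f (Some ((\<rho> \<circ> x) b)) = Some (y b)"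
      using less.hyps[of "\<rho> \<circ> x"] iso by auto
    have "f \<circ> plane_reflection n m \<in> mobius_group"
      by (intro mobius_group_comp f inversion_in_mobius_group[OF inversion_in.plane] n)
    moreover have "\<forall>b\<in>B. (f \<circ> plane_reflection n m) (Some (x b)) = Some (y b)"
      using f by (simp add: reflection del: plane_reflection.simps(2))
    ultimately show ?thesis
      using f(2) by (intro bexI[of _ "f \<circ> plane_reflection n m"]) auto
  qed
qed

section \<open>From equal ratios to a similarity\<close>

text \<open>The hypothesis says that the quotient of corresponding distances is unchanged when one
  endpoint of a pair is replaced. Since the quotient is symmetric, both endpoints can be exchanged
  in turn, and it is constant.\<close>

lemma similar_if_ratios_eq:
  fixes x y :: "'i \<Rightarrow> 'a::real_normed_vector"
  assumes inj: "inj_on x B" "inj_on y B"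
    and ratio: "\<And>a b c. a \<in> B \<Longrightarrow> b \<in> B \<Longrightarrow> c \<in> B \<Longrightarrow> distinct [a, b, c] \<Longrightarrow>
      norm (x b - x c) / norm (x a - x c) = norm (y b - y c) / norm (y a - y c)"
  obtains k where "k > 0" "\<And>a b. a \<in> B \<Longrightarrow> b \<in> B \<Longrightarrow> norm (y a - y b) = k * norm (x a - x b)"
proof (cases "\<exists>a b. a \<in> B \<and> b \<in> B \<and> a \<noteq> b")
  \<comment> \<open>With at most one index all distances are 0, so any positive factor will
    do.\<close>
  case False
  then have "\<And>a b. a \<in> B \<Longrightarrow> b \<in> B \<Longrightarrow> norm (y a - y b) = 1 * norm (x a - x b)"
    by (metis diff_self mult_1 norm_zero)
  then show ?thesis
    using that[of 1] by simp
next
  case True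
  then obtain a b where ab: "a \<in> B" "b \<in> B" "a \<noteq> b"
    by blast
  define q where "q c d = norm (y c - y d) / norm (x c - x d)" for c d
  have pos: "norm (x c - x d) > 0" "norm (y c - y d) > 0" if "c \<in> B" "d \<in> B" "c \<noteq> d" for c d
    using inj that by (auto dest: inj_onD)
  have commute: "q c d = q d c" for c d
    by (simp add: q_def norm_minus_commute)
  have step: "q c d = q e d" if "c \<in> B" "d \<in> B" "e \<in> B" "c \<noteq> d" "e \<noteq> d" for c d e
  proof (cases "c = e")
    case False
    then have "norm (x c - x d) / norm (x e - x d) = norm (y c - y d) / norm (y e - y d)"
      using ratio[of e c d] that by auto
    then show ?thesis
      using pos[of c d] pos[of e d] that by (simp add: q_def field_simps)
  qed simp
  have q: "q c d = q a b" if "c \<in> B" "d \<in> B" "c \<noteq> d" for c d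
  \<comment> \<open>The general chain is \<open>q c d = q a d = q d a = q b a = q a b\<close>. Its
    first link would produce the degenerate pair \<open>q a a\<close> if \<open>d = a\<close>, where
    \<open>q c a = q b a\<close> is used directly.\<close>
  proof (cases "d = a")
    case True
    then show ?thesis
      using step[of c a b] commute that ab by metis
  next
    case False
    then show ?thesis
      using step[of c d a] step[of d a b] commute that ab by metis
  qed
  show ?thesis
  proof (rule that)
    show "q a b > 0"
      using pos[OF ab] by (simp add: q_def)
    show "norm (y c - y d) = q a b * norm (x c - x d)" if "c \<in> B" "d \<in> B" for c d
    proof (cases "c = d")
      case False
      then show ?thesis
        using q[OF that] pos(1)[OF that] by (simp add: q_def field_simps)
    qed simp
  qed
qed

section \<open>Families through infinity and the general case\<close>

text \<open>With first entry \<open>infty\<close>, the cross-ratio reduces to a quotient of two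
  distances with a common endpoint, which is the hypothesis of
  \<open>similar_if_ratios_eq\<close>.\<close>

lemma mobius_if_cross_ratios_eq_infty:
  fixes p p' :: "'i \<Rightarrow> 'n::finite ext_space"
  assumes inj: "inj_on p A" "inj_on p' A"
    and \<omega>: "\<omega> \<in> A" "p \<omega> = infty" "p' \<omega> = infty"
    and ratio: "\<And>\<beta> \<gamma> \<delta>. \<beta> \<in> A \<Longrightarrow> \<gamma> \<in> A \<Longrightarrow> \<delta> \<in> A \<Longrightarrow> distinct [\<omega>, \<beta>, \<gamma>, \<delta>] \<Longrightarrow>
      abs_cross_ratio (p \<omega>) (p \<beta>) (p \<gamma>) (p \<delta>) = abs_cross_ratio (p' \<omega>) (p' \<beta>) (p' \<gamma>) (p' \<delta>)"
  shows "\<exists>f\<in>mobius_group. \<forall>\<alpha>\<in>A. f (p \<alpha>) = p' \<alpha>"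
proof -
  define B where "B = A - {\<omega>}"
  \<comment> \<open>By injectivity only the index \<omega> is sent to \<open>infty\<close>, so on
    \<open>B\<close> the function \<open>the\<close> returns the actual points.\<close>
  define x y where "x a = the (p a)" and "y a = the (p' a)" for a
  have p: "p a = Some (x a)" "p' a = Some (y a)" if "a \<in> B" for a
    using inj \<omega> that unfolding B_def x_def y_def
    by (metis DiffD1 DiffD2 inj_onD option.exhaust_sel singletonI)+
  have "inj_on x B" "inj_on y B"
    using inj p by (auto simp: inj_on_def B_def)
  moreover have "norm (x b - x c) / norm (x a - x c) = norm (y b - y c) / norm (y a - y c)"
    if "a \<in> B" "b \<in> B" "c \<in> B" "distinct [a, b, c]" for a b c
    using ratio[of a b c] that p \<omega> by (auto simp: B_def abs_cross_ratio_def)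
  ultimately obtain k where k: "k > 0"
      "\<And>a b. a \<in> B \<Longrightarrow> b \<in> B \<Longrightarrow> norm (y a - y b) = k * norm (x a - x b)"
    using similar_if_ratios_eq by blast
  obtain g :: "'n ext_space \<Rightarrow> 'n ext_space" where g: "g \<in> mobius_group" "g infty = infty"
      "\<And>z. g (Some z) = Some (k *\<^sub>R z)"
    using mobius_scaling[OF k(1)] by blast
  have "norm (k *\<^sub>R x a - k *\<^sub>R x b) = norm (y a - y b)" if "a \<in> B" "b \<in> B" for a b
    using k that by (simp flip: scaleR_diff_right)
  then obtain f where f: "f \<in> mobius_group" "f infty = infty"
      "\<forall>a\<in>B. f (Some (k *\<^sub>R x a)) = Some (y a)"
    using mobius_extends_isometry[of B "\<lambda>a. k *\<^sub>R x a" y] by blast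
  have "(f \<circ> g) (p a) = p' a" if "a \<in> A" for a
    using that f g p \<omega> by (cases "a = \<omega>") (simp_all add: B_def)
  then show ?thesis
    using mobius_group_comp[OF f(1) g(1)] by blast
qed

theorem theorem2:
  fixes p p' :: "'i \<Rightarrow> 'n::finite ext_space" and A :: "'i set"
  assumes "inj_on p A" and "inj_on p' A"
  shows "(\<exists>f\<in>mobius_group. \<forall>\<alpha>\<in>A. f (p \<alpha>) = p' \<alpha>) \<longleftrightarrow>
    (\<forall>\<alpha>\<in>A. \<forall>\<beta>\<in>A. \<forall>\<gamma>\<in>A. \<forall>\<delta>\<in>A. distinct [\<alpha>, \<beta>, \<gamma>, \<delta>] \<longrightarrow>
      abs_cross_ratio (p \<alpha>) (p \<beta>) (p \<gamma>) (p \<delta>) = abs_cross_ratio (p' \<alpha>) (p' \<beta>) (p' \<gamma>) (p' \<delta>))"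
    (is "?L \<longleftrightarrow> ?R")
proof
  \<comment> \<open>Stated for an arbitrary family \<open>q\<close>: one direction applies it to
    \<open>p\<close>, the other to both \<open>p\<close> and \<open>p'\<close> with their
    normalising maps.\<close>
  have invariant: "abs_cross_ratio (g (q \<alpha>)) (g (q \<beta>)) (g (q \<gamma>)) (g (q \<delta>))
      = abs_cross_ratio (q \<alpha>) (q \<beta>) (q \<gamma>) (q \<delta>)"
    if "g \<in> mobius_group" "inj_on q A" "\<alpha> \<in> A" "\<beta> \<in> A" "\<gamma> \<in> A" "\<delta> \<in> A" "distinct [\<alpha>, \<beta>, \<gamma>, \<delta>]"
    for g \<alpha> \<beta> \<gamma> \<delta> and q :: "'i \<Rightarrow> 'n ext_space"
    using that by (intro abs_cross_ratio_mobius) (auto simp: inj_on_eq_iff)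
  {
    assume ?L
    then obtain f where "f \<in> mobius_group" "\<forall>\<alpha>\<in>A. f (p \<alpha>) = p' \<alpha>"
      by blast
    then show ?R
      using invariant[OF _ assms(1)] by metis
  next
    assume ratio: ?R
    show ?L
    proof (cases "A = {}")
      case True
      then show ?thesis
        using mobius_group_id by blast
    next
      case False
      then obtain \<omega> where \<omega>: "\<omega> \<in> A"
        by blast
      obtain g where g: "g \<in> mobius_group" "g (p \<omega>) = infty"
        using mobius_to_infty by blast
      obtain g' where g': "g' \<in> mobius_group" "g' (p' \<omega>) = infty" "\<And>q. g' (g' q) = q"
        using mobius_to_infty[of "p' \<omega>"] by blast
      have "inj_on (g \<circ> p) A" "inj_on (g' \<circ> p') A"
        using assms inj_mobius[OF g(1)] inj_mobius[OF g'(1)]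
        by (auto intro!: comp_inj_on intro: inj_on_subset)
      moreover have "abs_cross_ratio ((g \<circ> p) \<omega>) ((g \<circ> p) \<beta>) ((g \<circ> p) \<gamma>) ((g \<circ> p) \<delta>)
          = abs_cross_ratio ((g' \<circ> p') \<omega>) ((g' \<circ> p') \<beta>) ((g' \<circ> p') \<gamma>) ((g' \<circ> p') \<delta>)"
        if "\<beta> \<in> A" "\<gamma> \<in> A" "\<delta> \<in> A" "distinct [\<omega>, \<beta>, \<gamma>, \<delta>]" for \<beta> \<gamma> \<delta>
        using ratio invariant[OF g(1) assms(1) \<omega> that] invariant[OF g'(1) assms(2) \<omega> that] \<omega> that
        by (simp only: comp_apply)
      ultimately obtain f where f: "f \<in> mobius_group" "\<forall>\<alpha>\<in>A. f ((g \<circ> p) \<alpha>) = (g' \<circ> p') \<alpha>"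
        using mobius_if_cross_ratios_eq_infty[of "g \<circ> p" A "g' \<circ> p'" \<omega>] \<omega> g(2) g'(2)
        by (metis comp_apply)
      \<comment> \<open>Applying the involution \<open>g'\<close> to both sides of the equation for
        \<open>f\<close> recovers \<open>p'\<close>.\<close>
      then have "\<forall>\<alpha>\<in>A. (g' \<circ> (f \<circ> g)) (p \<alpha>) = p' \<alpha>"
        using g'(3) by simp
      then show ?thesis
        using mobius_group_comp[OF g'(1) mobius_group_comp[OF f(1) g(1)]] by blast
    qed
  }
qed

end
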